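(* For the two-dimensional ten-moment Gaussian closure equations with source terms, the DG methods described in the context (with forward Euler time discretization) are well-balanced (WB) for a general known hydrostatic state, i.e. one satisfying $$(p_{11}^e)_x=-\tfrac12\rho^eW_x,\qquad p_{12}^e=C_0\ \text{(a constant)},\qquad (p_{22}^e)_y=-\tfrac12\rho^eW_y,\qquad \mathbf u^e=\mathbf 0 .$$ Here well-balanced means: if $\mathbf U_h$ is at the (projected) equilibrium state, i.e. on every cell $$\mathbf U_h=\Big(\rho_h^e,0,0,\tfrac12p_{11,h}^e,\tfrac12C_0,\tfrac12p_{22,h}^e\Big)^\top,$$ then the right-hand side of the scheme vanishes for all test functions $v\in\mathbb V_h^k$, and hence $\mathbf U_h^{\rm new}=\mathbf U_h$.
   Context: **States.** $\mathbf U=(\rho,m_1,m_2,E_{11},E_{12},E_{22})^\top\in\mathbb R^6$, $\mathbf m=(m_1,m_2)^\top$, $\mathbf E$ the symmetric $2\times2$ matrix with entries $E_{11},E_{12},E_{22}$; $\mathbf u=(u_1,u_2)^\top=\mathbf m/\rho$ is the velocity and $\mathbf p=(p_{ij})=2\mathbf E-\mathbf m\mathbf m^\top/\rho$ the symmetric pressure tensor. **Equations.** $\partial_t\mathbf U+\partial_x\mathbf F(\mathbf U)+\partial_y\mathbf G(\mathbf U)=\mathbf S^x(\mathbf U)+\mathbf S^y(\mathbf U)$, where $\mathbf F=(\rho u_1,\rho u_1^2+p_{11},\rho u_1u_2+p_{12},(E_{11}+p_{11})u_1,E_{12}u_1+\frac12(p_{11}u_2+p_{12}u_1),E_{22}u_1+p_{12}u_2)^\top$,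 $\mathbf G=(\rho u_2,\rho u_1u_2+p_{12},\rho u_2^2+p_{22},E_{11}u_2+p_{12}u_1,E_{12}u_2+\frac12(p_{12}u_2+p_{22}u_1),(E_{22}+p_{22})u_2)^\top$, $\mathbf S^x=(0,-\frac12\rho W_x,0,-\frac12\rho u_1W_x,-\frac14\rho u_2W_x,0)^\top$, $\mathbf S^y=(0,0,-\frac12\rho W_y,0,-\frac14\rho u_1W_y,-\frac12\rho u_2W_y)^\top$, $W$ a known potential. **HLLC fluxes.** $\mathbf F^{hllc},\mathbf G^{hllc}$ are the HLLC (Harten-Lax-van Leer-contact) numerical fluxes of the system in the $x$- and $y$-directions. Known contact property: $\mathbf F^{hllc}(\mathbf U_L,\mathbf U_R)=(0,p_{11},p_{12},0,0,0)^\top$ whenever $\mathbf U_{L}=(\rho_{L},0,0,\frac{p_{11}}2,\frac{p_{12}}2,\frac{p_{22,L}}2)^\top$, $\mathbf U_R=(\rho_R,0,0,\frac{p_{11}}2,\frac{p_{12}}2,\frac{p_{22,R}}2)^\top$; and, in the $y$-direction, $\mathbf G^{hllc}(\mathbf U_L,\mathbf U_R)=(0,p_{12},p_{22},0,0,0)^\top$ whenever $\mathbf U_L=(\rho_L,0,0,\frac{p_{11,L}}2,\frac{p_{12}}2,\frac{p_{22}}2)^\top$, $\mathbf U_R=(\rho_R,0,0,\frac{p_{11,R}}2,\frac{p_{12}}2,\frac{p_{22}}2)^\top$. **Mesh.** $\mathcal K_h$ is a uniform Cartesian partition of the domain with cells $K=[x_{i-\frac12},x_{i+\frac12}]\times[y_{l-\frac12},y_{l+\frac12}]$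 of sides $\Delta x,\Delta y$, $|K|=\Delta x\Delta y$; $\mathbb V_h^k$ is the space of functions that are polynomials of degree up to $k$ on each $K$; superscripts at an interface coordinate denote limits from the left/below ($-$) and right/above ($+$). $\{x_i^{(\mu)}\}_{\mu=1}^N,\{y_l^{(\mu)}\}_{\mu=1}^N$ are the $N$-point Gauss quadrature points in $[x_{i-\frac12},x_{i+\frac12}]$, $[y_{l-\frac12},y_{l+\frac12}]$, with weights $\omega_\mu$ normalized by $\sum_\mu\omega_\mu=1$. $(\cdot)_{i,l}^{\mu_1,\mu_2}$ is the value at $(x_i^{(\mu_1)},y_l^{(\mu_2)})$ and $\overline{(\cdot)}_K$ the cell average over $K$. **Projected equilibrium.** $\rho_h^e,p_{11,h}^e,p_{12,h}^e,p_{22,h}^e$ are the $L^2$-projections of $\rho^e,p_{11}^e,p_{12}^e,p_{22}^e$ onto $\mathbb V_h^k$ (so $p_{12,h}^e=C_0$), and $\mathbf p_h^e=\begin{pmatrix}p_{11,h}^e&C_0\\C_0&p_{22,h}^e\end{pmatrix}$. For $y\in[y_{l-\frac12},y_{l+\frac12}]$, $x\in[x_{i-\frac12},x_{i+\frac12}]$: $p_{11,i+\frac12,l}^{e,*}(y)=\max\{p_{11,h}^e(x_{i+\frac12}^-,y),p_{11,h}^e(x_{i+\frac12}^+,y)\}$, $p_{22,i,l+\frac12}^{e,*}(x)=\max\{p_{22,h}^e(x,y_{l+\frac12}^-),p_{22,h}^e(x,y_{l+\frac12}^+)\}$, $\mathbf p_{i+\frac12,l}^{e,\pm,*}(y)=\begin{pmatrix}p_{11,i+\frac12,l}^{e,*}(y)&C_0\\C_0&p_{22,h}^e(x_{i+\frac12}^\pm,y)\end{pmatrix}$,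 $\mathbf p_{i,l+\frac12}^{e,*,\pm}(x)=\begin{pmatrix}p_{11,h}^e(x,y_{l+\frac12}^\pm)&C_0\\C_0&p_{22,i,l+\frac12}^{e,*}(x)\end{pmatrix}$. $\mathbf T_{i+\frac12,l}^\pm(y)$ are upper triangular matrices $\begin{pmatrix}t_1&t_2\\0&1\end{pmatrix}$ and $\mathbf T_{i,l+\frac12}^\pm(x)$ lower triangular matrices $\begin{pmatrix}1&0\\t_4&t_3\end{pmatrix}$ such that $\mathbf p_{i+\frac12,l}^{e,\pm,*}(y)=\mathbf T_{i+\frac12,l}^\pm(y)\,\mathbf p_h^e(x_{i+\frac12}^\pm,y)\,\mathbf T_{i+\frac12,l}^\pm(y)^\top$ and $\mathbf p_{i,l+\frac12}^{e,*,\pm}(x)=\mathbf T_{i,l+\frac12}^\pm(x)\,\mathbf p_h^e(x,y_{l+\frac12}^\pm)\,\mathbf T_{i,l+\frac12}^\pm(x)^\top$; explicitly $t_1=\sqrt{\det\mathbf p_{i+\frac12,l}^{e,\pm,*}(y)/\det\mathbf p_h^e(x_{i+\frac12}^\pm,y)}$, $t_2=C_0(1-t_1)/p_{22,h}^e(x_{i+\frac12}^\pm,y)$, $t_3=\sqrt{\det\mathbf p_{i,l+\frac12}^{e,*,\pm}(x)/\det\mathbf p_h^e(x,y_{l+\frac12}^\pm)}$, $t_4=C_0(1-t_3)/p_{11,h}^e(x,y_{l+\frac12}^\pm)$. **Modified states.** $\widehat{\mathbf U}_{i+\frac12,l}^{\pm,\mu}$ is obtained from $\mathbf U_h(x_{i+\frac12}^\pm,y_l^{(\mu)})$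 by $\widehat\rho=\rho,\ \widehat{\mathbf m}=\mathbf T\mathbf m,\ \widehat{\mathbf E}=\mathbf T\mathbf E\mathbf T^\top$ with $\mathbf T=\mathbf T_{i+\frac12,l}^\pm(y_l^{(\mu)})$; $\widehat{\mathbf U}_{i,l+\frac12}^{\mu,\pm}$ likewise from $\mathbf U_h(x_i^{(\mu)},y_{l+\frac12}^\pm)$ with $\mathbf T=\mathbf T_{i,l+\frac12}^\pm(x_i^{(\mu)})$. **Discrete terms.** With $v_{i+\frac12,l}^{\pm,\mu}=v(x_{i+\frac12}^\pm,y_l^{(\mu)})$, $v_{i,l+\frac12}^{\mu,\pm}=v(x_i^{(\mu)},y_{l+\frac12}^\pm)$: $\langle\widehat{\mathbf F},v\rangle_y=\Delta y\sum_\mu\omega_\mu[\mathbf F^{hllc}(\widehat{\mathbf U}_{i+\frac12,l}^{-,\mu},\widehat{\mathbf U}_{i+\frac12,l}^{+,\mu})v_{i+\frac12,l}^{-,\mu}-\mathbf F^{hllc}(\widehat{\mathbf U}_{i-\frac12,l}^{-,\mu},\widehat{\mathbf U}_{i-\frac12,l}^{+,\mu})v_{i-\frac12,l}^{+,\mu}]$, $\langle\widehat{\mathbf G},v\rangle_x=\Delta x\sum_\mu\omega_\mu[\mathbf G^{hllc}(\widehat{\mathbf U}_{i,l+\frac12}^{\mu,-},\widehat{\mathbf U}_{i,l+\frac12}^{\mu,+})v_{i,l+\frac12}^{\mu,-}-\mathbf G^{hllc}(\widehat{\mathbf U}_{i,l-\frac12}^{\mu,-},\widehat{\mathbf U}_{i,l-\frac12}^{\mu,+})v_{i,l-\frac12}^{\mu,+}]$,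 $\langle\mathbf F(\mathbf U_h),v_x\rangle_K=|K|\sum_{\mu_1,\mu_2}\omega_{\mu_1}\omega_{\mu_2}(\mathbf F(\mathbf U_h)v_x)_{i,l}^{\mu_1,\mu_2}$ and $\langle\mathbf G(\mathbf U_h),v_y\rangle_K=|K|\sum_{\mu_1,\mu_2}\omega_{\mu_1}\omega_{\mu_2}(\mathbf G(\mathbf U_h)v_y)_{i,l}^{\mu_1,\mu_2}$. For a scalar $w\in\mathbb V_h^k$ define $$X(w;v)=|K|\sum_{\mu_1,\mu_2}\omega_{\mu_1}\omega_{\mu_2}\Big[\Big(\frac w{\rho_h^e}\Big)_{i,l}^{\mu_1,\mu_2}-\frac{\overline w_K}{\overline{(\rho_h^e)}_K}\Big]((p_{11,h}^e)_xv)_{i,l}^{\mu_1,\mu_2}+\frac{\overline w_K}{\overline{(\rho_h^e)}_K}\Big[\Delta y\sum_\mu\omega_\mu\big(p_{11,i+\frac12,l}^{e,*}(y_l^{(\mu)})v_{i+\frac12,l}^{-,\mu}-p_{11,i-\frac12,l}^{e,*}(y_l^{(\mu)})v_{i-\frac12,l}^{+,\mu}\big)-|K|\sum_{\mu_1,\mu_2}\omega_{\mu_1}\omega_{\mu_2}(p_{11,h}^ev_x)_{i,l}^{\mu_1,\mu_2}\Big],$$ $$Y(w;v)=|K|\sum_{\mu_1,\mu_2}\omega_{\mu_1}\omega_{\mu_2}\Big[\Big(\frac w{\rho_h^e}\Big)_{i,l}^{\mu_1,\mu_2}-\frac{\overline w_K}{\overline{(\rho_h^e)}_K}\Big]((p_{22,h}^e)_yv)_{i,l}^{\mu_1,\mu_2}+\frac{\overline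 w_K}{\overline{(\rho_h^e)}_K}\Big[\Delta x\sum_\mu\omega_\mu\big(p_{22,i,l+\frac12}^{e,*}(x_i^{(\mu)})v_{i,l+\frac12}^{\mu,-}-p_{22,i,l-\frac12}^{e,*}(x_i^{(\mu)})v_{i,l-\frac12}^{\mu,+}\big)-|K|\sum_{\mu_1,\mu_2}\omega_{\mu_1}\omega_{\mu_2}(p_{22,h}^ev_y)_{i,l}^{\mu_1,\mu_2}\Big].$$ **Scheme.** Given $\mathbf U_h\in[\mathbb V_h^k]^6$ and a time step $\Delta t$, $\mathbf U_h^{\rm new}\in[\mathbb V_h^k]^6$ satisfies, for all $K\in\mathcal K_h$ and $v\in\mathbb V_h^k$, $$\int_K\frac{\mathbf U_h^{\rm new}-\mathbf U_h}{\Delta t}v\,dx\,dy=\langle\mathbf F(\mathbf U_h),v_x\rangle_K+\langle\mathbf G(\mathbf U_h),v_y\rangle_K-\langle\widehat{\mathbf F},v\rangle_y-\langle\widehat{\mathbf G},v\rangle_x+\big(0,X(\rho_h;v),0,X(m_{1,h};v),X(\tfrac12m_{2,h};v),0\big)^\top+\big(0,0,Y(\rho_h;v),0,Y(\tfrac12m_{1,h};v),Y(m_{2,h};v)\big)^\top.$$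
   Formalization: The formal theorem assumes k ≤ 2N for the N-point Gauss rule (without it the claim fails when C_0 ≠ 0, e.g. N=1, k=3), and that the projected equilibrium has positive density and positive definite pressure at the points used, with positive cell averages of density. *)

theory Defs
  imports "HOL-Analysis.Analysis"
begin

section \<open>States, pressure tensor and physical fluxes\<close>

text \<open>A state is \<open>U = (\<rho>, m\<^sub>1, m\<^sub>2, E\<^sub>1\<^sub>1, E\<^sub>1\<^sub>2, E\<^sub>2\<^sub>2)\<close>, indexed by \<open>1, \<dots>, 6\<close>.\<close>

type_synonym state = "real^6"

lemma vector_6 [simp]:
  "(vector [a, b, c, d, e, f] :: ('a::zero)^6) $ 1 = a"
  "(vector [a, b, c, d, e, f] :: ('a::zero)^6) $ 2 = b"
  "(vector [a, b, c, d, e, f] :: ('a::zero)^6) $ 3 = c"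
  "(vector [a, b, c, d, e, f] :: ('a::zero)^6) $ 4 = d"
  "(vector [a, b, c, d, e, f] :: ('a::zero)^6) $ 5 = e"
  "(vector [a, b, c, d, e, f] :: ('a::zero)^6) $ 6 = f"
  unfolding vector_def by simp_all

lemma exhaust_6:
  fixes x :: 6
  shows "x = 1 \<or> x = 2 \<or> x = 3 \<or> x = 4 \<or> x = 5 \<or> x = 6"
proof (induct x)
  case (of_int z)
  then have "z = 0 \<or> z = 1 \<or> z = 2 \<or> z = 3 \<or> z = 4 \<or> z = 5" by auto
  then show ?case by auto
qed

definition mat22 :: "real \<Rightarrow> real \<Rightarrow> real \<Rightarrow> real \<Rightarrow> real^2^2" where
  "mat22 a b c d = vector [vector [a, b], vector [c, d]]"

definition momentum :: "state \<Rightarrow> real^2" where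
  "momentum U = vector [U$2, U$3]"

definition energy :: "state \<Rightarrow> real^2^2" where
  "energy U = mat22 (U$4) (U$5) (U$5) (U$6)"

definition velocity :: "state \<Rightarrow> real^2" where
  "velocity U = (1 / U$1) *\<^sub>R momentum U"

definition pressure :: "state \<Rightarrow> real^2^2" where
  "pressure U = 2 *\<^sub>R energy U - (1 / U$1) *\<^sub>R (\<chi> i j. momentum U $ i * momentum U $ j)"

definition flux_F :: "state \<Rightarrow> state" where
  "flux_F U =
    (let \<rho> = U$1; E11 = U$4; E12 = U$5; E22 = U$6;
         u1 = velocity U $ 1; u2 = velocity U $ 2;
         p11 = pressure U $ 1 $ 1; p12 = pressure U $ 1 $ 2
     in vector [\<rho> * u1, \<rho> * u1\<^sup>2 + p11, \<rho> * u1 * u2 + p12, (E11 + p11) * u1,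
                E12 * u1 + (p11 * u2 + p12 * u1) / 2, E22 * u1 + p12 * u2])"

definition flux_G :: "state \<Rightarrow> state" where
  "flux_G U =
    (let \<rho> = U$1; E11 = U$4; E12 = U$5; E22 = U$6;
         u1 = velocity U $ 1; u2 = velocity U $ 2;
         p12 = pressure U $ 1 $ 2; p22 = pressure U $ 2 $ 2
     in vector [\<rho> * u2, \<rho> * u1 * u2 + p12, \<rho> * u2\<^sup>2 + p22, E11 * u2 + p12 * u1,
                E12 * u2 + (p12 * u2 + p22 * u1) / 2, (E22 + p22) * u2])"

definition positive_definite :: "real^'n^'n \<Rightarrow> bool" where
  "positive_definite A \<longleftrightarrow> (\<forall>z. z \<noteq> 0 \<longrightarrow> 0 < z \<bullet> (A *v z))"

definition admissible :: "state \<Rightarrow> bool" where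
  "admissible U \<longleftrightarrow> 0 < U$1 \<and> positive_definite (pressure U)"

definition rest_state :: "real \<Rightarrow> real \<Rightarrow> real \<Rightarrow> real \<Rightarrow> state" where
  "rest_state \<rho> p11 p12 p22 = vector [\<rho>, 0, 0, p11 / 2, p12 / 2, p22 / 2]"


section \<open>Contact property of the HLLC fluxes\<close>

text \<open>
  The theorem uses the HLLC fluxes only through their exact resolution of stationary contacts,
  whatever wave speed estimates are chosen. The property is demanded for admissible states only,
  since the HLLC flux is not meaningful for other states.
\<close>

definition contact_property_x :: "(state \<Rightarrow> state \<Rightarrow> state) \<Rightarrow> bool" where
  "contact_property_x Fhllc \<longleftrightarrow>
    (\<forall>\<rho>L \<rho>R p11 p12 p22L p22R.
       admissible (rest_state \<rho>L p11 p12 p22L) \<longrightarrow> admissible (rest_state \<rho>R p11 p12 p22R) \<longrightarrow>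
       Fhllc (rest_state \<rho>L p11 p12 p22L) (rest_state \<rho>R p11 p12 p22R)
         = vector [0, p11, p12, 0, 0, 0])"

definition contact_property_y :: "(state \<Rightarrow> state \<Rightarrow> state) \<Rightarrow> bool" where
  "contact_property_y Ghllc \<longleftrightarrow>
    (\<forall>\<rho>L \<rho>R p11L p11R p12 p22.
       admissible (rest_state \<rho>L p11L p12 p22) \<longrightarrow> admissible (rest_state \<rho>R p11R p12 p22) \<longrightarrow>
       Ghllc (rest_state \<rho>L p11L p12 p22) (rest_state \<rho>R p11R p12 p22)
         = vector [0, p12, p22, 0, 0, 0])"


section \<open>Mesh and quadrature\<close>

text \<open>
  The cells of the mesh are \<open>K\<^sub>i\<^sub>,\<^sub>l\<close> with \<open>1 \<le> i \<le> nx\<close> and \<open>1 \<le> l \<le> ny\<close>. The interface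
  \<open>x\<^bsub>i+1/2\<^esub>\<close> is \<open>xface g i\<close>, so \<open>x\<^bsub>i-1/2\<^esub>\<close> is \<open>xface g (i - 1)\<close>. The nodes and weights
  are those of a Gauss rule on the reference interval \<open>[-1, 1]\<close>.
\<close>

record grid =
  xmin :: real
  ymin :: real
  dx :: real
  dy :: real
  nx :: int
  ny :: int
  npts :: nat
  node :: "nat \<Rightarrow> real"
  weight :: "nat \<Rightarrow> real"

text \<open>
  The \<open>n\<close>-point Gauss rule: \<open>n\<close> distinct nodes, exact for polynomials of degree at most
  \<open>2 n - 1\<close>. The factor 1/2 is the normalization of the weights to total mass one.
\<close>

definition gauss_rule :: "nat \<Rightarrow> (nat \<Rightarrow> real) \<Rightarrow> (nat \<Rightarrow> real) \<Rightarrow> bool" where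
  "gauss_rule n \<xi> \<omega> \<longleftrightarrow>
     1 \<le> n \<and> inj_on \<xi> {1..n} \<and> \<xi> ` {1..n} \<subseteq> {-1..1} \<and>
     (\<forall>q :: real poly. degree q \<le> 2 * n - 1 \<longrightarrow>
        (\<Sum>\<mu>=1..n. \<omega> \<mu> * poly q (\<xi> \<mu>)) = integral {-1..1} (poly q) / 2)"

definition valid_grid :: "grid \<Rightarrow> bool" where
  "valid_grid g \<longleftrightarrow> 0 < dx g \<and> 0 < dy g \<and> 1 \<le> nx g \<and> 1 \<le> ny g \<and>
     gauss_rule (npts g) (node g) (weight g)"

definition xface :: "grid \<Rightarrow> int \<Rightarrow> real" where
  "xface g i = xmin g + of_int i * dx g"

definition yface :: "grid \<Rightarrow> int \<Rightarrow> real" where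
  "yface g l = ymin g + of_int l * dy g"

definition cell :: "grid \<Rightarrow> int \<Rightarrow> int \<Rightarrow> (real \<times> real) set" where
  "cell g i l = cbox (xface g (i - 1), yface g (l - 1)) (xface g i, yface g l)"

definition cell_indices :: "grid \<Rightarrow> (int \<times> int) set" where
  "cell_indices g = {1..nx g} \<times> {1..ny g}"

text \<open>
  The outer traces on the boundary of the domain are taken from one layer of ghost cells adjacent
  to the boundary edges.
\<close>

definition ext_cell_indices :: "grid \<Rightarrow> (int \<times> int) set" where
  "ext_cell_indices g = {0..nx g + 1} \<times> {1..ny g} \<union> {1..nx g} \<times> {0..ny g + 1}"

definition domain_interior :: "grid \<Rightarrow> (real \<times> real) set" where
  "domain_interior g = box (xface g 0, yface g 0) (xface g (nx g), yface g (ny g))"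

definition xnode :: "grid \<Rightarrow> int \<Rightarrow> nat \<Rightarrow> real" where
  "xnode g i \<mu> = (xface g (i - 1) + xface g i) / 2 + dx g / 2 * node g \<mu>"

definition ynode :: "grid \<Rightarrow> int \<Rightarrow> nat \<Rightarrow> real" where
  "ynode g l \<mu> = (yface g (l - 1) + yface g l) / 2 + dy g / 2 * node g \<mu>"

definition quad_x :: "grid \<Rightarrow> int \<Rightarrow> (real \<Rightarrow> 'a::real_vector) \<Rightarrow> 'a" where
  "quad_x g i f = dx g *\<^sub>R (\<Sum>\<mu>=1..npts g. weight g \<mu> *\<^sub>R f (xnode g i \<mu>))"

definition quad_y :: "grid \<Rightarrow> int \<Rightarrow> (real \<Rightarrow> 'a::real_vector) \<Rightarrow> 'a" where
  "quad_y g l f = dy g *\<^sub>R (\<Sum>\<mu>=1..npts g. weight g \<mu> *\<^sub>R f (ynode g l \<mu>))"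

definition quad_cell :: "grid \<Rightarrow> int \<Rightarrow> int \<Rightarrow> (real \<Rightarrow> real \<Rightarrow> 'a::real_vector) \<Rightarrow> 'a" where
  "quad_cell g i l f = (dx g * dy g) *\<^sub>R
     (\<Sum>\<mu>1=1..npts g. \<Sum>\<mu>2=1..npts g.
        (weight g \<mu>1 * weight g \<mu>2) *\<^sub>R f (xnode g i \<mu>1) (ynode g l \<mu>2))"

definition cell_avg :: "grid \<Rightarrow> int \<Rightarrow> int \<Rightarrow> (real \<Rightarrow> real \<Rightarrow> real) \<Rightarrow> real" where
  "cell_avg g i l f = integral (cell g i l) (\<lambda>(x, y). f x y) / (dx g * dy g)"

text \<open>The points of \<open>K\<^sub>i\<^sub>,\<^sub>l\<close> at which the scheme evaluates the numerical solution.\<close>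

definition quad_points :: "grid \<Rightarrow> int \<Rightarrow> int \<Rightarrow> (real \<times> real) set" where
  "quad_points g i l =
     (let X = xnode g i ` {1..npts g}; Y = ynode g l ` {1..npts g}
      in X \<times> Y \<union> {xface g (i - 1), xface g i} \<times> Y \<union> X \<times> {yface g (l - 1), yface g l})"


section \<open>Piecewise polynomials and projected equilibrium\<close>

text \<open>
  An element of the discontinuous space is represented by its family of polynomials, one for each
  cell index. The one-sided limit at an edge of a cell is then the value there of the polynomial
  of that cell.
\<close>

type_synonym 'a piecewise = "int \<Rightarrow> int \<Rightarrow> real \<Rightarrow> real \<Rightarrow> 'a"

definition poly_deg_le :: "nat \<Rightarrow> (real \<Rightarrow> real \<Rightarrow> real) \<Rightarrow> bool" where
  "poly_deg_le k f \<longleftrightarrow>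
     (\<exists>c. \<forall>x y. f x y = (\<Sum>a\<le>k. \<Sum>b\<le>k - a. c a b * x ^ a * y ^ b))"

definition DG_space :: "(int \<times> int) set \<Rightarrow> nat \<Rightarrow> real piecewise set" where
  "DG_space I k = {v. \<forall>(i, l)\<in>I. poly_deg_le k (v i l)}"

definition DG_space6 :: "(int \<times> int) set \<Rightarrow> nat \<Rightarrow> state piecewise set" where
  "DG_space6 I k = {U. \<forall>n. (\<lambda>i l x y. U i l x y $ n) \<in> DG_space I k}"

definition Dx :: "(real \<Rightarrow> real \<Rightarrow> real) \<Rightarrow> real \<Rightarrow> real \<Rightarrow> real" where
  "Dx f x y = deriv (\<lambda>s. f s y) x"

definition Dy :: "(real \<Rightarrow> real \<Rightarrow> real) \<Rightarrow> real \<Rightarrow> real \<Rightarrow> real" where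
  "Dy f x y = deriv (\<lambda>s. f x s) y"

definition square_integrable :: "(real \<times> real) set \<Rightarrow> (real \<Rightarrow> real \<Rightarrow> real) \<Rightarrow> bool" where
  "square_integrable K f \<longleftrightarrow>
     set_borel_measurable lebesgue K (\<lambda>(x, y). f x y) \<and>
     set_integrable lebesgue K (\<lambda>(x, y). (f x y)\<^sup>2)"

definition is_L2_projection ::
  "grid \<Rightarrow> (int \<times> int) set \<Rightarrow> nat \<Rightarrow> (real \<Rightarrow> real \<Rightarrow> real) \<Rightarrow> real piecewise \<Rightarrow> bool" where
  "is_L2_projection g I k f q \<longleftrightarrow>
     q \<in> DG_space I k \<and>
     (\<forall>(i, l)\<in>I. square_integrable (cell g i l) f \<and>
        (\<forall>v. poly_deg_le k v \<longrightarrow>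
           integral (cell g i l) (\<lambda>(x, y). f x y * v x y)
             = integral (cell g i l) (\<lambda>(x, y). q i l x y * v x y)))"

definition hydrostatic ::
  "(real \<times> real) set \<Rightarrow> (real \<Rightarrow> real \<Rightarrow> real) \<Rightarrow> real \<Rightarrow> (real \<Rightarrow> real \<Rightarrow> state) \<Rightarrow> bool" where
  "hydrostatic D W C Ue \<longleftrightarrow>
     (\<forall>(x, y)\<in>D.
        0 < Ue x y $ 1 \<and> velocity (Ue x y) = 0 \<and> pressure (Ue x y) $ 1 $ 2 = C \<and>
        (\<exists>Wx Wy.
           ((\<lambda>s. W s y) has_real_derivative Wx) (at x) \<and>
           ((\<lambda>s. W x s) has_real_derivative Wy) (at y) \<and>
           ((\<lambda>s. pressure (Ue s y) $ 1 $ 1) has_real_derivative - (1/2) * Ue x y $ 1 * Wx) (at x) \<and>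
           ((\<lambda>s. pressure (Ue x s) $ 2 $ 2) has_real_derivative - (1/2) * Ue x y $ 1 * Wy) (at y)))"

text \<open>
  The projected equilibrium. The off-diagonal entry \<open>C0\<close> of the pressure is a constant, which
  is its own projection.
\<close>

record equilibrium =
  rho_h :: "real piecewise"
  p11_h :: "real piecewise"
  p22_h :: "real piecewise"
  C0 :: real

definition projected_equilibrium ::
  "grid \<Rightarrow> nat \<Rightarrow> (real \<Rightarrow> real \<Rightarrow> state) \<Rightarrow> equilibrium \<Rightarrow> bool" where
  "projected_equilibrium g k Ue e \<longleftrightarrow>
     is_L2_projection g (ext_cell_indices g) k (\<lambda>x y. Ue x y $ 1) (rho_h e) \<and>
     is_L2_projection g (ext_cell_indices g) k (\<lambda>x y. pressure (Ue x y) $ 1 $ 1) (p11_h e) \<and>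
     is_L2_projection g (ext_cell_indices g) k (\<lambda>x y. pressure (Ue x y) $ 2 $ 2) (p22_h e)"

definition equilibrium_state :: "equilibrium \<Rightarrow> state piecewise" where
  "equilibrium_state e i l x y =
     vector [rho_h e i l x y, 0, 0, p11_h e i l x y / 2, C0 e / 2, p22_h e i l x y / 2]"

definition admissible_equilibrium :: "grid \<Rightarrow> equilibrium \<Rightarrow> bool" where
  "admissible_equilibrium g e \<longleftrightarrow>
     (\<forall>(i, l)\<in>ext_cell_indices g. \<forall>(x, y)\<in>quad_points g i l.
        admissible (equilibrium_state e i l x y)) \<and>
     (\<forall>(i, l)\<in>cell_indices g. 0 < cell_avg g i l (rho_h e i l))"


section \<open>Modified states\<close>

definition p_h :: "equilibrium \<Rightarrow> int \<Rightarrow> int \<Rightarrow> real \<Rightarrow> real \<Rightarrow> real^2^2" where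
  "p_h e i l x y = mat22 (p11_h e i l x y) (C0 e) (C0 e) (p22_h e i l x y)"

definition p11_star :: "grid \<Rightarrow> equilibrium \<Rightarrow> int \<Rightarrow> int \<Rightarrow> real \<Rightarrow> real" where
  "p11_star g e i l y = max (p11_h e i l (xface g i) y) (p11_h e (i + 1) l (xface g i) y)"

definition p22_star :: "grid \<Rightarrow> equilibrium \<Rightarrow> int \<Rightarrow> int \<Rightarrow> real \<Rightarrow> real" where
  "p22_star g e i l x = max (p22_h e i l x (yface g l)) (p22_h e i (l + 1) x (yface g l))"

text \<open>
  In the definitions for the vertical interface \<open>x\<^bsub>i+1/2\<^esub>\<close>, the argument \<open>j\<close> is the column
  whose trace is taken: \<open>j = i\<close> for the superscript \<open>-\<close> and \<open>j = i + 1\<close> for \<open>+\<close>.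
  For the horizontal interface \<open>y\<^bsub>l+1/2\<^esub>\<close> the row \<open>j\<close> is \<open>l\<close> or \<open>l + 1\<close> likewise.
\<close>

definition p_star_x :: "grid \<Rightarrow> equilibrium \<Rightarrow> int \<Rightarrow> int \<Rightarrow> int \<Rightarrow> real \<Rightarrow> real^2^2" where
  "p_star_x g e i l j y = mat22 (p11_star g e i l y) (C0 e) (C0 e) (p22_h e j l (xface g i) y)"

definition p_star_y :: "grid \<Rightarrow> equilibrium \<Rightarrow> int \<Rightarrow> int \<Rightarrow> int \<Rightarrow> real \<Rightarrow> real^2^2" where
  "p_star_y g e i l j x = mat22 (p11_h e i j x (yface g l)) (C0 e) (C0 e) (p22_star g e i l x)"

definition T_x :: "grid \<Rightarrow> equilibrium \<Rightarrow> int \<Rightarrow> int \<Rightarrow> int \<Rightarrow> real \<Rightarrow> real^2^2" where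
  "T_x g e i l j y =
     (let t1 = sqrt (det (p_star_x g e i l j y) / det (p_h e j l (xface g i) y));
          t2 = C0 e * (1 - t1) / p22_h e j l (xface g i) y
      in mat22 t1 t2 0 1)"

definition T_y :: "grid \<Rightarrow> equilibrium \<Rightarrow> int \<Rightarrow> int \<Rightarrow> int \<Rightarrow> real \<Rightarrow> real^2^2" where
  "T_y g e i l j x =
     (let t3 = sqrt (det (p_star_y g e i l j x) / det (p_h e i j x (yface g l)));
          t4 = C0 e * (1 - t3) / p11_h e i j x (yface g l)
      in mat22 1 0 t4 t3)"

text \<open>The matrices \<open>T_x\<close> and \<open>T_y\<close> map the projected pressure to the modified pressure.\<close>

lemma congruence_aux:
  fixes a b c d t :: real
  assumes "0 < a * c - b\<^sup>2" and "c \<noteq> 0" and "t\<^sup>2 = (d * c - b\<^sup>2) / (a * c - b\<^sup>2)"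
  shows "(t * a + b * (1 - t) / c * b) * t + (t * b + b * (1 - t) / c * c) * (b * (1 - t) / c) = d"
proof -
  have "(t * a + b * (1 - t) / c * b) * t + (t * b + b * (1 - t) / c * c) * (b * (1 - t) / c)
      = (t\<^sup>2 * (a * c - b\<^sup>2) + b\<^sup>2) / c"
    using assms(2) by (simp add: field_simps power2_eq_square)
  also have "t\<^sup>2 * (a * c - b\<^sup>2) = d * c - b\<^sup>2"
    using assms(1,3) by simp
  finally show ?thesis using assms(2) by simp
qed

lemma T_x_congruence:
  assumes "0 < det (p_h e j l (xface g i) y)" and "0 \<le> det (p_star_x g e i l j y)"
    and "0 < p22_h e j l (xface g i) y"
  shows "T_x g e i l j y ** p_h e j l (xface g i) y ** transpose (T_x g e i l j y)
           = p_star_x g e i l j y"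
proof -
  define a where "a = p11_h e j l (xface g i) y"
  define c where "c = p22_h e j l (xface g i) y"
  define d where "d = p11_star g e i l y"
  define b where "b = C0 e"
  define t where "t = sqrt ((d * c - b\<^sup>2) / (a * c - b\<^sup>2))"
  have D: "0 < a * c - b\<^sup>2" "0 \<le> d * c - b\<^sup>2" "c \<noteq> 0"
    using assms by (simp_all add: p_h_def p_star_x_def mat22_def det_2 a_def b_def c_def d_def
      power2_eq_square)
  have t2: "t\<^sup>2 = (d * c - b\<^sup>2) / (a * c - b\<^sup>2)"
    using D by (simp add: t_def)
  define s where "s = b * (1 - t) / c"
  have s: "t * b + s * c = b"
    using D(3) by (simp add: s_def field_simps)
  have eqs: "p_h e j l (xface g i) y = mat22 a b b c" "p_star_x g e i l j y = mat22 d b b c"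
      "T_x g e i l j y = mat22 t s 0 1"
    by (simp_all add: p_h_def p_star_x_def T_x_def Let_def a_def b_def c_def d_def t_def s_def mat22_def
      det_2 power2_eq_square)
  show ?thesis
    unfolding eqs using congruence_aux[OF D(1) D(3) t2, folded s_def] s
    by (simp add: vec_eq_iff forall_2 mat22_def matrix_matrix_mult_def transpose_def sum_2
      algebra_simps)
qed

lemma T_y_congruence:
  assumes "0 < det (p_h e i j x (yface g l))" and "0 \<le> det (p_star_y g e i l j x)"
    and "0 < p11_h e i j x (yface g l)"
  shows "T_y g e i l j x ** p_h e i j x (yface g l) ** transpose (T_y g e i l j x)
           = p_star_y g e i l j x"
proof -
  define a where "a = p22_h e i j x (yface g l)"
  define c where "c = p11_h e i j x (yface g l)"
  define d where "d = p22_star g e i l x"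
  define b where "b = C0 e"
  define t where "t = sqrt ((d * c - b\<^sup>2) / (a * c - b\<^sup>2))"
  have D: "0 < a * c - b\<^sup>2" "0 \<le> d * c - b\<^sup>2" "c \<noteq> 0"
    using assms by (simp_all add: p_h_def p_star_y_def mat22_def det_2 a_def b_def c_def d_def
      power2_eq_square mult.commute)
  have t2: "t\<^sup>2 = (d * c - b\<^sup>2) / (a * c - b\<^sup>2)"
    using D by (simp add: t_def)
  define s where "s = b * (1 - t) / c"
  have s: "t * b + s * c = b"
    using D(3) by (simp add: s_def field_simps)
  have eqs: "p_h e i j x (yface g l) = mat22 c b b a" "p_star_y g e i l j x = mat22 c b b d"
      "T_y g e i l j x = mat22 1 0 s t"
    by (simp_all add: p_h_def p_star_y_def T_y_def Let_def a_def b_def c_def d_def t_def s_def mat22_def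
      det_2 power2_eq_square mult.commute)
  show ?thesis
    unfolding eqs using congruence_aux[OF D(1) D(3) t2, folded s_def] s
    by (simp add: vec_eq_iff forall_2 mat22_def matrix_matrix_mult_def transpose_def sum_2
      algebra_simps)
qed

definition transform_state :: "real^2^2 \<Rightarrow> state \<Rightarrow> state" where
  "transform_state T U =
     (let m = T *v momentum U; E = T ** energy U ** transpose T
      in vector [U$1, m$1, m$2, E$1$1, E$1$2, E$2$2])"

definition Uhat_x ::
  "grid \<Rightarrow> equilibrium \<Rightarrow> state piecewise \<Rightarrow> int \<Rightarrow> int \<Rightarrow> int \<Rightarrow> real \<Rightarrow> state" where
  "Uhat_x g e U i l j y = transform_state (T_x g e i l j y) (U j l (xface g i) y)"

definition Uhat_y ::
  "grid \<Rightarrow> equilibrium \<Rightarrow> state piecewise \<Rightarrow> int \<Rightarrow> int \<Rightarrow> int \<Rightarrow> real \<Rightarrow> state" where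
  "Uhat_y g e U i l j x = transform_state (T_y g e i l j x) (U i j x (yface g l))"


section \<open>The scheme\<close>

definition surface_F ::
  "grid \<Rightarrow> equilibrium \<Rightarrow> (state \<Rightarrow> state \<Rightarrow> state) \<Rightarrow> state piecewise \<Rightarrow>
   int \<Rightarrow> int \<Rightarrow> real piecewise \<Rightarrow> state" where
  "surface_F g e Fhllc U i l v =
     quad_y g l (\<lambda>y.
       v i l (xface g i) y *\<^sub>R Fhllc (Uhat_x g e U i l i y) (Uhat_x g e U i l (i + 1) y)
       - v i l (xface g (i - 1)) y *\<^sub>R
           Fhllc (Uhat_x g e U (i - 1) l (i - 1) y) (Uhat_x g e U (i - 1) l i y))"

definition surface_G ::
  "grid \<Rightarrow> equilibrium \<Rightarrow> (state \<Rightarrow> state \<Rightarrow> state) \<Rightarrow> state piecewise \<Rightarrow>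
   int \<Rightarrow> int \<Rightarrow> real piecewise \<Rightarrow> state" where
  "surface_G g e Ghllc U i l v =
     quad_x g i (\<lambda>x.
       v i l x (yface g l) *\<^sub>R Ghllc (Uhat_y g e U i l l x) (Uhat_y g e U i l (l + 1) x)
       - v i l x (yface g (l - 1)) *\<^sub>R
           Ghllc (Uhat_y g e U i (l - 1) (l - 1) x) (Uhat_y g e U i (l - 1) l x))"

definition volume_F :: "grid \<Rightarrow> state piecewise \<Rightarrow> int \<Rightarrow> int \<Rightarrow> real piecewise \<Rightarrow> state" where
  "volume_F g U i l v = quad_cell g i l (\<lambda>x y. Dx (v i l) x y *\<^sub>R flux_F (U i l x y))"

definition volume_G :: "grid \<Rightarrow> state piecewise \<Rightarrow> int \<Rightarrow> int \<Rightarrow> real piecewise \<Rightarrow> state" where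
  "volume_G g U i l v = quad_cell g i l (\<lambda>x y. Dy (v i l) x y *\<^sub>R flux_G (U i l x y))"

definition source_X ::
  "grid \<Rightarrow> equilibrium \<Rightarrow> int \<Rightarrow> int \<Rightarrow> real piecewise \<Rightarrow> real piecewise \<Rightarrow> real" where
  "source_X g e i l w v =
     (let r = cell_avg g i l (w i l) / cell_avg g i l (rho_h e i l) in
      quad_cell g i l (\<lambda>x y.
        (w i l x y / rho_h e i l x y - r) * (Dx (p11_h e i l) x y * v i l x y))
      + r * (quad_y g l (\<lambda>y.
               p11_star g e i l y * v i l (xface g i) y
               - p11_star g e (i - 1) l y * v i l (xface g (i - 1)) y)
             - quad_cell g i l (\<lambda>x y. p11_h e i l x y * Dx (v i l) x y)))"

definition source_Y ::
  "grid \<Rightarrow> equilibrium \<Rightarrow> int \<Rightarrow> int \<Rightarrow> real piecewise \<Rightarrow> real piecewise \<Rightarrow> real" where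
  "source_Y g e i l w v =
     (let r = cell_avg g i l (w i l) / cell_avg g i l (rho_h e i l) in
      quad_cell g i l (\<lambda>x y.
        (w i l x y / rho_h e i l x y - r) * (Dy (p22_h e i l) x y * v i l x y))
      + r * (quad_x g i (\<lambda>x.
               p22_star g e i l x * v i l x (yface g l)
               - p22_star g e i (l - 1) x * v i l x (yface g (l - 1)))
             - quad_cell g i l (\<lambda>x y. p22_h e i l x y * Dy (v i l) x y)))"

definition DG_rhs ::
  "grid \<Rightarrow> equilibrium \<Rightarrow> (state \<Rightarrow> state \<Rightarrow> state) \<Rightarrow> (state \<Rightarrow> state \<Rightarrow> state) \<Rightarrow>
   state piecewise \<Rightarrow> int \<Rightarrow> int \<Rightarrow> real piecewise \<Rightarrow> state" where
  "DG_rhs g e Fhllc Ghllc U i l v =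
     (let \<rho> = (\<lambda>i l x y. U i l x y $ 1);
          m1 = (\<lambda>i l x y. U i l x y $ 2);
          m2 = (\<lambda>i l x y. U i l x y $ 3)
      in volume_F g U i l v + volume_G g U i l v
         - surface_F g e Fhllc U i l v - surface_G g e Ghllc U i l v
         + vector [0, source_X g e i l \<rho> v, 0, source_X g e i l m1 v,
                   source_X g e i l (\<lambda>i l x y. m2 i l x y / 2) v, 0]
         + vector [0, 0, source_Y g e i l \<rho> v, 0,
                   source_Y g e i l (\<lambda>i l x y. m1 i l x y / 2) v, source_Y g e i l m2 v])"

definition euler_step ::
  "grid \<Rightarrow> nat \<Rightarrow> equilibrium \<Rightarrow> (state \<Rightarrow> state \<Rightarrow> state) \<Rightarrow> (state \<Rightarrow> state \<Rightarrow> state) \<Rightarrow>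
   real \<Rightarrow> state piecewise \<Rightarrow> state piecewise \<Rightarrow> bool" where
  "euler_step g k e Fhllc Ghllc dt U Unew \<longleftrightarrow>
     Unew \<in> DG_space6 (cell_indices g) k \<and>
     (\<forall>(i, l)\<in>cell_indices g. \<forall>v\<in>DG_space (cell_indices g) k.
        integral (cell g i l)
          (\<lambda>(x, y). v i l x y *\<^sub>R ((1 / dt) *\<^sub>R (Unew i l x y - U i l x y)))
        = DG_rhs g e Fhllc Ghllc U i l v)"

end

(*
At the projected equilibrium all states are at rest. The matrices T turn the two traces at an
interface into rest states that share p12 = C0 and the normal pressure p^*, so the contact property
makes the numerical flux equal to (0, p11^*, C0, 0, 0, 0) or (0, C0, p22^*, 0, 0, 0). The weight
rho_h / rho_h^e in the source is 1, hence the source is exactly the surface minus volume terms of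
p11 and p22 and cancels them. The C0 terms cancel by Gauss exactness. For the time step, each
component of U_new - U_h is itself a test function, so its square has integral zero.
*)
theory Submission
  imports Defs
begin

lemma forall_6: "(\<forall>i::6. P i) \<longleftrightarrow> P 1 \<and> P 2 \<and> P 3 \<and> P 4 \<and> P 5 \<and> P 6"
  by (metis exhaust_6)

section \<open>Polynomials and exactness of the quadrature\<close>

text \<open>Freezing \<open>y\<close> and collecting powers of \<open>x\<close> bounds the degree of
  the slice by \<open>k\<close>. This reduces the exactness of the two-dimensional rule to
  one-dimensional Gauss rules along grid lines.\<close>

lemma poly_deg_le_slice_x:
  assumes "poly_deg_le k f"
  obtains p where "degree p \<le> k" and "\<And>x. f x y = poly p x"
proof -
  obtain c where c: "\<And>x y. f x y = (\<Sum>a\<le>k. \<Sum>b\<le>k - a. c a b * x ^ a * y ^ b)"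
    using assms unfolding poly_deg_le_def by blast
  define p where "p = (\<Sum>a\<le>k. monom (\<Sum>b\<le>k - a. c a b * y ^ b) a)"
  have "degree p \<le> k"
    unfolding p_def by (intro degree_sum_le) (auto intro: order_trans[OF degree_monom_le])
  moreover have "f x y = poly p x" for x
    by (simp add: c p_def poly_sum poly_monom sum_distrib_left sum_distrib_right mult_ac)
  ultimately show ?thesis by (rule that)
qed

lemma poly_deg_le_slice_y:
  assumes "poly_deg_le k f"
  obtains p where "degree p \<le> k" and "\<And>y. f x y = poly p y"
proof -
  obtain c where c: "\<And>x y. f x y = (\<Sum>a\<le>k. \<Sum>b\<le>k - a. c a b * x ^ a * y ^ b)"
    using assms unfolding poly_deg_le_def by blast
  define p where "p = (\<Sum>a\<le>k. \<Sum>b\<le>k - a. monom (c a b * x ^ a) b)"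
  have "degree p \<le> k"
    unfolding p_def by (intro degree_sum_le) (auto intro: order_trans[OF degree_monom_le])
  moreover have "f x y = poly p y" for y
    by (simp add: c p_def poly_sum poly_monom)
  ultimately show ?thesis by (rule that)
qed

lemma poly_deg_le_continuous_on:
  assumes "poly_deg_le k f"
  shows "continuous_on S (\<lambda>(x, y). f x y)"
proof -
  obtain c where "\<And>x y. f x y = (\<Sum>a\<le>k. \<Sum>b\<le>k - a. c a b * x ^ a * y ^ b)"
    using assms unfolding poly_deg_le_def by blast
  then show ?thesis
    by (simp add: case_prod_unfold) (intro continuous_intros)
qed

lemma poly_deg_le_diff:
  assumes "poly_deg_le k f" and "poly_deg_le k h"
  shows "poly_deg_le k (\<lambda>x y. f x y - h x y)"
proof -
  obtain c where "\<And>x y. f x y = (\<Sum>a\<le>k. \<Sum>b\<le>k - a. c a b * x ^ a * y ^ b)"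
    using assms(1) unfolding poly_deg_le_def by blast
  moreover obtain d where "\<And>x y. h x y = (\<Sum>a\<le>k. \<Sum>b\<le>k - a. d a b * x ^ a * y ^ b)"
    using assms(2) unfolding poly_deg_le_def by blast
  ultimately have "f x y - h x y = (\<Sum>a\<le>k. \<Sum>b\<le>k - a. (c a b - d a b) * x ^ a * y ^ b)" for x y
    by (simp add: sum_subtractf left_diff_distrib)
  then show ?thesis unfolding poly_deg_le_def by (intro exI[of _ "\<lambda>a b. c a b - d a b"]) simp
qed

text \<open>The affine substitution t -> m + h/2 t carries an interval of length \<open>h\<close> to
  the reference interval. Gauss exactness turns the sum into an integral, and the fundamental
  theorem of calculus leaves the boundary values.\<close>

lemma gauss_rule_pderiv:
  assumes "gauss_rule n \<xi> \<omega>" and "degree p \<le> 2 * n" and "0 < h"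
  shows "h * (\<Sum>\<mu>=1..n. \<omega> \<mu> * poly (pderiv p) (m + h / 2 * \<xi> \<mu>))
           = poly p (m + h / 2) - poly p (m - h / 2)"
proof -
  define q where "q = pderiv p \<circ>\<^sub>p [:m, h / 2:]"
  have q: "poly q t = poly (pderiv p) (m + h / 2 * t)" for t
    by (simp add: q_def poly_pcompose mult.commute)
  \<comment> \<open>Differentiation lowers the degree bound to that of Gauss exactness, and the
    affine substitution preserves it.\<close>
  have "degree q \<le> 2 * n - 1"
    using assms(2,3) by (simp add: q_def degree_pcompose degree_pderiv)
  then have "(\<Sum>\<mu>=1..n. \<omega> \<mu> * poly q (\<xi> \<mu>)) = integral {-1..1} (poly q) / 2"
    using assms(1) unfolding gauss_rule_def by blast
  \<comment> \<open>The factor 2/h in the antiderivative compensates the factor h/2 of the chain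
    rule.\<close>
  moreover have "(poly q has_integral
      (2 / h * poly p (m + h / 2 * 1) - 2 / h * poly p (m + h / 2 * (- 1)))) {-1..1}"
  proof (rule fundamental_theorem_of_calculus)
    fix t :: real
    have "((\<lambda>t. 2 / h * poly p (m + h / 2 * t)) has_real_derivative poly q t)
        (at t within {-1..1})"
      using assms(3) unfolding q by (auto intro!: derivative_eq_intros)
    then show "((\<lambda>t. 2 / h * poly p (m + h / 2 * t)) has_vector_derivative poly q t)
        (at t within {-1..1})"
      by (simp add: has_real_derivative_iff_has_vector_derivative)
  qed simp
  ultimately show ?thesis
    using assms(3) by (simp add: q integral_unique field_simps)
qed

lemma quad_x_Dx:
  assumes "valid_grid g" and "poly_deg_le k f" and "k \<le> 2 * npts g"
  shows "quad_x g i (\<lambda>x. Dx f x y) = f (xface g i) y - f (xface g (i - 1)) y"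
proof -
  obtain p where p: "degree p \<le> k" "\<And>x. f x y = poly p x"
    using poly_deg_le_slice_x[OF assms(2)] by metis
  have "Dx f x y = poly (pderiv p) x" for x
    by (simp add: Dx_def p(2) DERIV_imp_deriv poly_DERIV)
  moreover have "(xface g (i - 1) + xface g i) / 2 + dx g / 2 = xface g i"
      "(xface g (i - 1) + xface g i) / 2 - dx g / 2 = xface g (i - 1)"
    by (simp_all add: xface_def field_simps)
  ultimately show ?thesis
    using gauss_rule_pderiv[of "npts g" "node g" "weight g" p "dx g" "(xface g (i - 1) + xface g i) / 2"]
      assms p by (simp add: quad_x_def xnode_def valid_grid_def)
qed

lemma quad_y_Dy:
  assumes "valid_grid g" and "poly_deg_le k f" and "k \<le> 2 * npts g"
  shows "quad_y g l (\<lambda>y. Dy f x y) = f x (yface g l) - f x (yface g (l - 1))"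
proof -
  obtain p where p: "degree p \<le> k" "\<And>y. f x y = poly p y"
    using poly_deg_le_slice_y[OF assms(2)] by metis
  have "Dy f x y = poly (pderiv p) y" for y
    by (simp add: Dy_def p(2) DERIV_imp_deriv poly_DERIV)
  moreover have "(yface g (l - 1) + yface g l) / 2 + dy g / 2 = yface g l"
      "(yface g (l - 1) + yface g l) / 2 - dy g / 2 = yface g (l - 1)"
    by (simp_all add: yface_def field_simps)
  ultimately show ?thesis
    using gauss_rule_pderiv[of "npts g" "node g" "weight g" p "dy g" "(yface g (l - 1) + yface g l) / 2"]
      assms p by (simp add: quad_y_def ynode_def valid_grid_def)
qed

text \<open>Either direction may serve as the inner sum, so the differentiated variable can always
  be integrated first.\<close>

lemma quad_cell_eq_iterated_xy: "quad_cell g i l f = quad_x g i (\<lambda>x. quad_y g l (\<lambda>y. f x y))"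
  by (simp add: quad_cell_def quad_x_def quad_y_def scaleR_sum_right mult_ac)

lemma quad_cell_eq_iterated_yx: "quad_cell g i l f = quad_y g l (\<lambda>y. quad_x g i (\<lambda>x. f x y))"
  unfolding quad_cell_def quad_x_def quad_y_def
  by (subst sum.swap) (simp add: scaleR_sum_right mult_ac)

text \<open>A discrete divergence theorem: the inner sum in \<open>x\<close> collapses exactly to
  the edge traces, and the outer sum samples them at the same nodes as the surface terms.\<close>

lemma quad_cell_Dx:
  assumes "valid_grid g" and "poly_deg_le k f" and "k \<le> 2 * npts g"
  shows "quad_cell g i l (Dx f) = quad_y g l (\<lambda>y. f (xface g i) y - f (xface g (i - 1)) y)"
  using quad_x_Dx[OF assms] by (simp add: quad_cell_eq_iterated_yx)

lemma quad_cell_Dy: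
  assumes "valid_grid g" and "poly_deg_le k f" and "k \<le> 2 * npts g"
  shows "quad_cell g i l (Dy f) = quad_x g i (\<lambda>x. f x (yface g l) - f x (yface g (l - 1)))"
  using quad_y_Dy[OF assms] by (simp add: quad_cell_eq_iterated_xy)

section \<open>Congruence, components and linearity of the quadrature sums\<close>

lemma quad_x_cong:
  "(\<And>\<mu>. \<mu> \<in> {1..npts g} \<Longrightarrow> f (xnode g i \<mu>) = h (xnode g i \<mu>)) \<Longrightarrow> quad_x g i f = quad_x g i h"
  by (simp add: quad_x_def)

lemma quad_y_cong:
  "(\<And>\<mu>. \<mu> \<in> {1..npts g} \<Longrightarrow> f (ynode g l \<mu>) = h (ynode g l \<mu>)) \<Longrightarrow> quad_y g l f = quad_y g l h"
  by (simp add: quad_y_def)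

lemma quad_cell_cong:
  "(\<And>\<mu> \<nu>. \<mu> \<in> {1..npts g} \<Longrightarrow> \<nu> \<in> {1..npts g} \<Longrightarrow>
      f (xnode g i \<mu>) (ynode g l \<nu>) = h (xnode g i \<mu>) (ynode g l \<nu>)) \<Longrightarrow>
    quad_cell g i l f = quad_cell g i l h"
  by (simp add: quad_cell_def)

lemma quad_x_component: "quad_x g i f $ n = quad_x g i (\<lambda>x. f x $ n)"
  by (simp add: quad_x_def)

lemma quad_y_component: "quad_y g l f $ n = quad_y g l (\<lambda>y. f y $ n)"
  by (simp add: quad_y_def)

lemma quad_cell_component: "quad_cell g i l f $ n = quad_cell g i l (\<lambda>x y. f x y $ n)"
  by (simp add: quad_cell_def)

lemma quad_x_zero [simp]: "quad_x g i (\<lambda>_. 0) = 0"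
  by (simp add: quad_x_def)

lemma quad_y_zero [simp]: "quad_y g l (\<lambda>_. 0) = 0"
  by (simp add: quad_y_def)

lemma quad_cell_zero [simp]: "quad_cell g i l (\<lambda>_ _. 0) = 0"
  by (simp add: quad_cell_def)

lemma quad_x_cmult: "quad_x g i (\<lambda>x. c * f x :: real) = c * quad_x g i f"
  by (simp add: quad_x_def sum_distrib_left mult_ac)

lemma quad_y_cmult: "quad_y g l (\<lambda>y. c * f y :: real) = c * quad_y g l f"
  by (simp add: quad_y_def sum_distrib_left mult_ac)

lemma quad_cell_cmult: "quad_cell g i l (\<lambda>x y. c * f x y :: real) = c * quad_cell g i l f"
  by (simp add: quad_cell_def sum_distrib_left mult_ac)

section \<open>Admissible states at rest\<close>

text \<open>Sylvester's criterion for symmetric 2x2 matrices, which makes admissibility of rest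
  states a matter of scalar inequalities.\<close>

lemma positive_definite_mat22:
  "positive_definite (mat22 a b b c) \<longleftrightarrow> 0 < a \<and> 0 < c \<and> b\<^sup>2 < a * c"
proof -
  have form: "z \<bullet> (mat22 a b b c *v z) = a * (z$1)\<^sup>2 + 2 * b * (z$1) * (z$2) + c * (z$2)\<^sup>2"
    for z :: "real^2"
    by (simp add: mat22_def inner_vec_def matrix_vector_mult_def sum_2 power2_eq_square algebra_simps)
  show ?thesis
  proof (intro iffI conjI)
    assume pd: "positive_definite (mat22 a b b c)"
    have pos: "0 < a * s\<^sup>2 + 2 * b * s * t + c * t\<^sup>2" if "s \<noteq> 0 \<or> t \<noteq> 0" for s t
    proof -
      have "vector [s, t] \<noteq> (0 :: real^2)"
        using that by (auto simp: vec_eq_iff forall_2)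
      then have "0 < vector [s, t] \<bullet> (mat22 a b b c *v vector [s, t])"
        using pd unfolding positive_definite_def by blast
      then show ?thesis unfolding form by simp
    qed
    show "0 < a" using pos[of 1 0] by simp
    show "0 < c" using pos[of 0 1] by simp
    \<comment> \<open>The test vector (-b, a) is orthogonal to the first row (a, b), so only the
      determinant survives in the form.\<close>
    have "0 < a * (a * c - b\<^sup>2)"
      using pos[of "- b" a] \<open>0 < a\<close> by (simp add: power2_eq_square algebra_simps)
    then show "b\<^sup>2 < a * c" using \<open>0 < a\<close> by (simp add: zero_less_mult_iff)
  next
    assume R: "0 < a \<and> 0 < c \<and> b\<^sup>2 < a * c"
    show "positive_definite (mat22 a b b c)"
      unfolding positive_definite_def form
    proof (intro allI impI)
      fix z :: "real^2"
      assume "z \<noteq> 0"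
      then have z: "z$1 \<noteq> 0 \<or> z$2 \<noteq> 0" by (auto simp: vec_eq_iff forall_2)
      \<comment> \<open>This is \<open>a\<close> times the quadratic form after completing the
        square. Its second term is positive if \<open>z$2\<close> is nonzero, its first
        otherwise.\<close>
      have "0 < (a * z$1 + b * z$2)\<^sup>2 + (a * c - b\<^sup>2) * (z$2)\<^sup>2"
      proof (cases "z$2 = 0")
        case True
        then show ?thesis using z R by simp
      next
        case False
        then show ?thesis using R by (intro add_nonneg_pos mult_pos_pos) auto
      qed
      also have "\<dots> = a * (a * (z$1)\<^sup>2 + 2 * b * (z$1) * (z$2) + c * (z$2)\<^sup>2)"
        by (simp add: power2_eq_square algebra_simps)
      finally show "0 < a * (z$1)\<^sup>2 + 2 * b * (z$1) * (z$2) + c * (z$2)\<^sup>2"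
        using R by (simp add: zero_less_mult_iff)
    qed
  qed
qed

section \<open>Fluxes and transformations of rest states\<close>

lemma momentum_rest_state [simp]: "momentum (rest_state \<rho> a b c) = 0"
  by (simp add: momentum_def rest_state_def vec_eq_iff forall_2)

lemma energy_rest_state: "energy (rest_state \<rho> a b c) = (1/2) *\<^sub>R mat22 a b b c"
  by (simp add: energy_def rest_state_def mat22_def vec_eq_iff forall_2)

lemma pressure_rest_state: "pressure (rest_state \<rho> a b c) = mat22 a b b c"
  unfolding pressure_def by (simp add: energy_rest_state vec_eq_iff)

lemma admissible_rest_state_iff:
  "admissible (rest_state \<rho> a b c) \<longleftrightarrow> 0 < \<rho> \<and> 0 < a \<and> 0 < c \<and> b\<^sup>2 < a * c"
  by (simp add: admissible_def pressure_rest_state positive_definite_mat22)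
     (simp add: rest_state_def)

lemma flux_F_rest_state: "flux_F (rest_state \<rho> a b c) = vector [0, a, b, 0, 0, 0]"
  by (simp add: flux_F_def velocity_def pressure_rest_state mat22_def)

lemma flux_G_rest_state: "flux_G (rest_state \<rho> a b c) = vector [0, b, c, 0, 0, 0]"
  by (simp add: flux_G_def velocity_def pressure_rest_state mat22_def)

text \<open>At rest the energy is half the pressure and the momentum is zero, so a congruence of
  pressures is already a transformation of states.\<close>

lemma transform_rest_state:
  assumes "T ** mat22 a b b c ** transpose T = mat22 a' b' b' c'"
  shows "transform_state T (rest_state \<rho> a b c) = rest_state \<rho> a' b' c'"
proof -
  have "T ** energy (rest_state \<rho> a b c) ** transpose T = (1/2) *\<^sub>R mat22 a' b' b' c'"
    by (simp add: energy_rest_state matrix_scalar_ac flip: assms scalar_matrix_assoc)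
  then show ?thesis
    unfolding transform_state_def Let_def momentum_rest_state
    by (simp add: rest_state_def mat22_def)
qed

lemma equilibrium_state_eq_rest_state:
  "equilibrium_state e i l x y =
     rest_state (rho_h e i l x y) (p11_h e i l x y) (C0 e) (p22_h e i l x y)"
  by (simp add: equilibrium_state_def rest_state_def)

text \<open>Taking the maximum of the two traces can only enlarge the determinant of the pressure, so
  that the modified states stay admissible.\<close>

lemma transform_T_x:
  assumes adm: "admissible (equilibrium_state e j l (xface g i) y)" and j: "j = i \<or> j = i + 1"
  defines "V \<equiv> rest_state (rho_h e j l (xface g i) y) (p11_star g e i l y) (C0 e)
                 (p22_h e j l (xface g i) y)"
  shows "transform_state (T_x g e i l j y) (equilibrium_state e j l (xface g i) y) = V"
    and "admissible V"
proof -
  define \<rho> a b c d where abcd: "\<rho> = rho_h e j l (xface g i) y" "a = p11_h e j l (xface g i) y"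
    "b = C0 e" "c = p22_h e j l (xface g i) y" "d = p11_star g e i l y"
  have R: "0 < \<rho>" "0 < a" "0 < c" "b\<^sup>2 < a * c"
    using adm by (simp_all add: equilibrium_state_eq_rest_state admissible_rest_state_iff abcd)
  have ad: "a \<le> d" using j by (auto simp: abcd p11_star_def)
  then have "a * c \<le> d * c" using R by (intro mult_right_mono) simp_all
  then have d: "0 < d" "b\<^sup>2 < d * c" using R ad by linarith+
  then show "admissible V"
    using R by (simp add: V_def admissible_rest_state_iff abcd)
  have "T_x g e i l j y ** mat22 a b b c ** transpose (T_x g e i l j y) = mat22 d b b c"
    using T_x_congruence[of e j l g i y] R d
    by (simp add: p_h_def p_star_x_def abcd mat22_def det_2 power2_eq_square)
  from transform_rest_state[OF this]
  show "transform_state (T_x g e i l j y) (equilibrium_state e j l (xface g i) y) = V"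
    by (simp add: V_def equilibrium_state_eq_rest_state abcd)
qed

text \<open>The mirror image of \<open>transform_T_x\<close>: the lower triangular matrix keeps
  \<open>p11_h\<close> and raises \<open>p22_h\<close> to the maximum of both traces.\<close>

lemma transform_T_y:
  assumes adm: "admissible (equilibrium_state e i j x (yface g l))" and j: "j = l \<or> j = l + 1"
  defines "V \<equiv> rest_state (rho_h e i j x (yface g l)) (p11_h e i j x (yface g l)) (C0 e)
                 (p22_star g e i l x)"
  shows "transform_state (T_y g e i l j x) (equilibrium_state e i j x (yface g l)) = V"
    and "admissible V"
proof -
  define \<rho> a b c d where abcd: "\<rho> = rho_h e i j x (yface g l)" "a = p11_h e i j x (yface g l)"
    "b = C0 e" "c = p22_h e i j x (yface g l)" "d = p22_star g e i l x"
  have R: "0 < \<rho>" "0 < a" "0 < c" "b\<^sup>2 < a * c"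
    using adm by (simp_all add: equilibrium_state_eq_rest_state admissible_rest_state_iff abcd)
  have cd: "c \<le> d" using j by (auto simp: abcd p22_star_def)
  then have "a * c \<le> a * d" using R by (intro mult_left_mono) simp_all
  then have d: "0 < d" "b\<^sup>2 < a * d" using R cd by linarith+
  then show "admissible V"
    using R by (simp add: V_def admissible_rest_state_iff abcd)
  have "T_y g e i l j x ** mat22 a b b c ** transpose (T_y g e i l j x) = mat22 a b b d"
    using T_y_congruence[of e i j x g l] R d
    by (simp add: p_h_def p_star_y_def abcd mat22_def det_2 power2_eq_square)
  from transform_rest_state[OF this]
  show "transform_state (T_y g e i l j x) (equilibrium_state e i j x (yface g l)) = V"
    by (simp add: V_def equilibrium_state_eq_rest_state abcd)
qed

section \<open>The residual at equilibrium\<close>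

text \<open>The midpoint has the form that \<open>xnode\<close> and \<open>ynode\<close> take once
  the upper face is written as the lower face plus the mesh width.\<close>

lemma affine_node_bounds:
  fixes t h :: real
  assumes "- 1 \<le> t" "t \<le> 1" "0 < h"
  shows "a \<le> (a + (a + h)) / 2 + h / 2 * t" "(a + (a + h)) / 2 + h / 2 * t \<le> a + h"
proof -
  have "h * (- 1) \<le> h * t" "h * t \<le> h * 1" using assms by (intro mult_left_mono; simp)+
  then show "a \<le> (a + (a + h)) / 2 + h / 2 * t" "(a + (a + h)) / 2 + h / 2 * t \<le> a + h"
    by (simp_all add: field_simps)
qed

lemma xface_pred: "xface g i = xface g (i - 1) + dx g"
  by (simp add: xface_def algebra_simps)

lemma yface_pred: "yface g l = yface g (l - 1) + dy g"
  by (simp add: yface_def algebra_simps)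

text \<open>The equilibrium is prescribed on cells while the scheme samples at quadrature points;
  this inclusion links the two.\<close>

lemma quad_points_subset_cell:
  assumes "valid_grid g"
  shows "quad_points g i l \<subseteq> cell g i l"
proof -
  have pos: "0 < dx g" "0 < dy g" and
    node: "\<mu> \<in> {1..npts g} \<Longrightarrow> - 1 \<le> node g \<mu> \<and> node g \<mu> \<le> 1" for \<mu>
    using assms by (auto simp: valid_grid_def gauss_rule_def image_subset_iff)
  have "xface g (i - 1) \<le> xnode g i \<mu> \<and> xnode g i \<mu> \<le> xface g i"
    "yface g (l - 1) \<le> ynode g l \<mu> \<and> ynode g l \<mu> \<le> yface g l" if "\<mu> \<in> {1..npts g}" for \<mu>
    using affine_node_bounds[of "node g \<mu>" "dx g" "xface g (i - 1)"]
      affine_node_bounds[of "node g \<mu>" "dy g" "yface g (l - 1)"] node[OF that] pos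
    by (simp_all add: xnode_def ynode_def xface_pred[of g i] yface_pred[of g l])
  moreover have "xface g (i - 1) \<le> xface g i" "yface g (l - 1) \<le> yface g l"
    using pos by (simp_all add: xface_pred[of g i] yface_pred[of g l])
  ultimately show ?thesis
    by (auto simp: quad_points_def Let_def cell_def cbox_Pair_eq)
qed

lemma cell_avg_cong:
  "(\<And>x y. (x, y) \<in> cell g i l \<Longrightarrow> f x y = h x y) \<Longrightarrow> cell_avg g i l f = cell_avg g i l h"
  unfolding cell_avg_def by (intro arg_cong2[where f = "(/)"] integral_cong) auto

text \<open>\<open>Uh_eq\<close> includes the ghost layer because the fluxes on the domain boundary
  take their outer traces from there.\<close>

locale discrete_equilibrium =
  fixes g :: grid and k :: nat and e :: equilibrium and Uh :: "state piecewise"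
  assumes grid: "valid_grid g"
    and quadrature_order: "k \<le> 2 * npts g"
    and adm: "admissible_equilibrium g e"
    and Uh_eq: "\<forall>(i, l)\<in>ext_cell_indices g. \<forall>(x, y)\<in>cell g i l.
                  Uh i l x y = equilibrium_state e i l x y"
begin

section \<open>Modified states and numerical fluxes at the interfaces\<close>

lemma at_quad_point:
  assumes "(i, l) \<in> ext_cell_indices g" and "(x, y) \<in> quad_points g i l"
  shows "Uh i l x y = equilibrium_state e i l x y" and "admissible (equilibrium_state e i l x y)"
proof -
  have "(x, y) \<in> cell g i l"
    using assms(2) quad_points_subset_cell[OF grid] by blast
  then show "Uh i l x y = equilibrium_state e i l x y"
    using bspec[OF Uh_eq assms(1)] by auto
  show "admissible (equilibrium_state e i l x y)"
    using adm assms unfolding admissible_equilibrium_def by blast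
qed

text \<open>Only the density and \<open>p22_h\<close> still depend on the side \<open>j\<close>. The
  two modified traces thus have the form of a stationary contact.\<close>

lemma Uhat_x:
  assumes "(j, l) \<in> ext_cell_indices g" and "\<mu> \<in> {1..npts g}" and "j = i \<or> j = i + 1"
  defines "V \<equiv> rest_state (rho_h e j l (xface g i) (ynode g l \<mu>)) (p11_star g e i l (ynode g l \<mu>))
                 (C0 e) (p22_h e j l (xface g i) (ynode g l \<mu>))"
  shows "Uhat_x g e Uh i l j (ynode g l \<mu>) = V" and "admissible V"
proof -
  \<comment> \<open>The face \<open>xface g i\<close> is the right edge of column \<open>i\<close>
    and the left edge of column \<open>i + 1\<close>, which covers both choices of
    \<open>j\<close>.\<close>
  have q: "(xface g i, ynode g l \<mu>) \<in> quad_points g j l"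
    using assms(2,3) by (auto simp: quad_points_def)
  note * = at_quad_point[OF assms(1) q]
  show "Uhat_x g e Uh i l j (ynode g l \<mu>) = V" and "admissible V"
    unfolding V_def Uhat_x_def *(1) by (rule transform_T_x[OF *(2) assms(3)])+
qed

lemma Uhat_y:
  assumes "(i, j) \<in> ext_cell_indices g" and "\<mu> \<in> {1..npts g}" and "j = l \<or> j = l + 1"
  defines "V \<equiv> rest_state (rho_h e i j (xnode g i \<mu>) (yface g l))
                 (p11_h e i j (xnode g i \<mu>) (yface g l)) (C0 e) (p22_star g e i l (xnode g i \<mu>))"
  shows "Uhat_y g e Uh i l j (xnode g i \<mu>) = V" and "admissible V"
proof -
  have q: "(xnode g i \<mu>, yface g l) \<in> quad_points g i j"
    using assms(2,3) by (auto simp: quad_points_def)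
  note * = at_quad_point[OF assms(1) q]
  show "Uhat_y g e Uh i l j (xnode g i \<mu>) = V" and "admissible V"
    unfolding V_def Uhat_y_def *(1) by (rule transform_T_y[OF *(2) assms(3)])+
qed

text \<open>The contact property is conditional on admissibility, so both conclusions of
  \<open>Uhat_x\<close> enter, once for each side.\<close>

lemma Fhllc_Uhat:
  assumes "contact_property_x Fhllc" and "\<mu> \<in> {1..npts g}"
    and "(i, l) \<in> ext_cell_indices g" "(i + 1, l) \<in> ext_cell_indices g"
  shows "Fhllc (Uhat_x g e Uh i l i (ynode g l \<mu>)) (Uhat_x g e Uh i l (i + 1) (ynode g l \<mu>))
           = vector [0, p11_star g e i l (ynode g l \<mu>), C0 e, 0, 0, 0]"
  using assms(1) Uhat_x[OF assms(3,2), of i] Uhat_x[OF assms(4,2), of i]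
  by (simp add: contact_property_x_def)

lemma Ghllc_Uhat:
  assumes "contact_property_y Ghllc" and "\<mu> \<in> {1..npts g}"
    and "(i, l) \<in> ext_cell_indices g" "(i, l + 1) \<in> ext_cell_indices g"
  shows "Ghllc (Uhat_y g e Uh i l l (xnode g i \<mu>)) (Uhat_y g e Uh i l (l + 1) (xnode g i \<mu>))
           = vector [0, C0 e, p22_star g e i l (xnode g i \<mu>), 0, 0, 0]"
  using assms(1) Uhat_y[OF assms(3,2), of l] Uhat_y[OF assms(4,2), of l]
  by (simp add: contact_property_y_def)

context
  fixes i l :: int
  assumes il: "(i, l) \<in> cell_indices g"
begin

text \<open>The ghost layer supplies all four neighbours even for cells at the domain
  boundary.\<close>

lemma neighbours:
  "(i, l) \<in> ext_cell_indices g" "(i + 1, l) \<in> ext_cell_indices g" "(i - 1, l) \<in> ext_cell_indices g"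
  "(i, l + 1) \<in> ext_cell_indices g" "(i, l - 1) \<in> ext_cell_indices g"
  using il by (auto simp: cell_indices_def ext_cell_indices_def)

lemma at_node:
  assumes "\<mu> \<in> {1..npts g}" "\<nu> \<in> {1..npts g}"
  shows "Uh i l (xnode g i \<mu>) (ynode g l \<nu>) = equilibrium_state e i l (xnode g i \<mu>) (ynode g l \<nu>)"
    and "0 < rho_h e i l (xnode g i \<mu>) (ynode g l \<nu>)"
proof -
  have "(xnode g i \<mu>, ynode g l \<nu>) \<in> quad_points g i l"
    using assms by (auto simp: quad_points_def)
  note at_quad_point[OF neighbours(1) this]
  then show "Uh i l (xnode g i \<mu>) (ynode g l \<nu>) = equilibrium_state e i l (xnode g i \<mu>) (ynode g l \<nu>)"
    and "0 < rho_h e i l (xnode g i \<mu>) (ynode g l \<nu>)"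
    by (simp_all add: equilibrium_state_eq_rest_state admissible_rest_state_iff)
qed

section \<open>The terms of the residual, evaluated one by one\<close>

lemma volume_F_equilibrium:
  "volume_F g Uh i l v =
     vector [0, quad_cell g i l (\<lambda>x y. p11_h e i l x y * Dx (v i l) x y),
             C0 e * quad_cell g i l (Dx (v i l)), 0, 0, 0]"
proof -
  have "volume_F g Uh i l v = quad_cell g i l (\<lambda>x y. Dx (v i l) x y *\<^sub>R
      vector [0, p11_h e i l x y, C0 e, 0, 0, 0])"
    unfolding volume_F_def
    by (rule quad_cell_cong) (simp add: at_node equilibrium_state_eq_rest_state flux_F_rest_state)
  then show ?thesis
    by (simp add: vec_eq_iff forall_6 quad_cell_component quad_cell_cmult mult.commute)
qed

lemma volume_G_equilibrium:
  "volume_G g Uh i l v =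
     vector [0, C0 e * quad_cell g i l (Dy (v i l)),
             quad_cell g i l (\<lambda>x y. p22_h e i l x y * Dy (v i l) x y), 0, 0, 0]"
proof -
  have "volume_G g Uh i l v = quad_cell g i l (\<lambda>x y. Dy (v i l) x y *\<^sub>R
      vector [0, C0 e, p22_h e i l x y, 0, 0, 0])"
    unfolding volume_G_def
    by (rule quad_cell_cong) (simp add: at_node equilibrium_state_eq_rest_state flux_G_rest_state)
  then show ?thesis
    by (simp add: vec_eq_iff forall_6 quad_cell_component quad_cell_cmult mult.commute)
qed

lemma surface_F_equilibrium:
  assumes "contact_property_x Fhllc"
  shows "surface_F g e Fhllc Uh i l v =
     vector [0, quad_y g l (\<lambda>y. p11_star g e i l y * v i l (xface g i) y
                              - p11_star g e (i - 1) l y * v i l (xface g (i - 1)) y),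
             C0 e * quad_y g l (\<lambda>y. v i l (xface g i) y - v i l (xface g (i - 1)) y), 0, 0, 0]"
proof -
  have "surface_F g e Fhllc Uh i l v = quad_y g l (\<lambda>y.
      v i l (xface g i) y *\<^sub>R vector [0, p11_star g e i l y, C0 e, 0, 0, 0]
      - v i l (xface g (i - 1)) y *\<^sub>R vector [0, p11_star g e (i - 1) l y, C0 e, 0, 0, 0])"
    unfolding surface_F_def
    \<comment> \<open>The instance at \<open>i - 1\<close> treats the left face, whose right-hand
      trace belongs to the cell itself.\<close>
    using Fhllc_Uhat[OF assms, of _ i l] Fhllc_Uhat[OF assms, of _ "i - 1" l] neighbours
    by (intro quad_y_cong) simp
  then show ?thesis
    by (simp add: vec_eq_iff forall_6 quad_y_component mult.commute right_diff_distrib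
        flip: quad_y_cmult)
qed

lemma surface_G_equilibrium:
  assumes "contact_property_y Ghllc"
  shows "surface_G g e Ghllc Uh i l v =
     vector [0, C0 e * quad_x g i (\<lambda>x. v i l x (yface g l) - v i l x (yface g (l - 1))),
             quad_x g i (\<lambda>x. p22_star g e i l x * v i l x (yface g l)
                           - p22_star g e i (l - 1) x * v i l x (yface g (l - 1))), 0, 0, 0]"
proof -
  have "surface_G g e Ghllc Uh i l v = quad_x g i (\<lambda>x.
      v i l x (yface g l) *\<^sub>R vector [0, C0 e, p22_star g e i l x, 0, 0, 0]
      - v i l x (yface g (l - 1)) *\<^sub>R vector [0, C0 e, p22_star g e i (l - 1) x, 0, 0, 0])"
    unfolding surface_G_def
    using Ghllc_Uhat[OF assms, of _ i l] Ghllc_Uhat[OF assms, of _ i "l - 1"] neighbours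
    by (intro quad_x_cong) simp
  then show ?thesis
    by (simp add: vec_eq_iff forall_6 quad_x_component mult.commute right_diff_distrib
        flip: quad_x_cmult)
qed

text \<open>The nodal ratio and the ratio of averages are both one. The correction sum therefore
  vanishes, and what remains is the discrete weak derivative of the pressure.\<close>

lemma source_rho:
  assumes "\<And>x y. (x, y) \<in> cell g i l \<Longrightarrow> w i l x y = rho_h e i l x y"
  shows "source_X g e i l w v =
           quad_y g l (\<lambda>y. p11_star g e i l y * v i l (xface g i) y
                         - p11_star g e (i - 1) l y * v i l (xface g (i - 1)) y)
           - quad_cell g i l (\<lambda>x y. p11_h e i l x y * Dx (v i l) x y)"
    and "source_Y g e i l w v =
           quad_x g i (\<lambda>x. p22_star g e i l x * v i l x (yface g l)
                         - p22_star g e i (l - 1) x * v i l x (yface g (l - 1)))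
           - quad_cell g i l (\<lambda>x y. p22_h e i l x y * Dy (v i l) x y)"
proof -
  \<comment> \<open>Admissibility makes the average of \<open>rho_h\<close> positive, so equal
    averages really have quotient one.\<close>
  have r: "cell_avg g i l (w i l) / cell_avg g i l (rho_h e i l) = 1"
    using il adm cell_avg_cong[OF assms] by (force simp: admissible_equilibrium_def)
  have ratio: "w i l (xnode g i \<mu>) (ynode g l \<nu>) / rho_h e i l (xnode g i \<mu>) (ynode g l \<nu>) = 1"
    if "\<mu> \<in> {1..npts g}" "\<nu> \<in> {1..npts g}" for \<mu> \<nu>
  proof -
    have "(xnode g i \<mu>, ynode g l \<nu>) \<in> cell g i l"
      using that quad_points_subset_cell[OF grid, of i l] by (force simp: quad_points_def)
    then show ?thesis using assms at_node(2)[OF that] by simp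
  qed
  have "quad_cell g i l (\<lambda>x y. (w i l x y / rho_h e i l x y - 1) * h x y)
      = quad_cell g i l (\<lambda>_ _. 0)" for h :: "real \<Rightarrow> real \<Rightarrow> real"
    by (rule quad_cell_cong) (simp only: ratio, simp)
  then show "source_X g e i l w v =
           quad_y g l (\<lambda>y. p11_star g e i l y * v i l (xface g i) y
                         - p11_star g e (i - 1) l y * v i l (xface g (i - 1)) y)
           - quad_cell g i l (\<lambda>x y. p11_h e i l x y * Dx (v i l) x y)"
    and "source_Y g e i l w v =
           quad_x g i (\<lambda>x. p22_star g e i l x * v i l x (yface g l)
                         - p22_star g e i (l - 1) x * v i l x (yface g (l - 1)))
           - quad_cell g i l (\<lambda>x y. p22_h e i l x y * Dy (v i l) x y)"
    unfolding source_X_def source_Y_def r by (simp_all add: Let_def)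
qed

text \<open>Intended for the momenta and their halves: both the nodal quotient and the quotient of
  averages have numerator zero.\<close>

lemma source_zero:
  assumes "\<And>x y. (x, y) \<in> cell g i l \<Longrightarrow> w i l x y = 0"
  shows "source_X g e i l w v = 0" and "source_Y g e i l w v = 0"
proof -
  have r: "cell_avg g i l (w i l) = 0"
    using cell_avg_cong[of g i l "w i l" "\<lambda>_ _. 0"] assms
    by (simp add: cell_avg_def[of _ _ _ "\<lambda>_ _. 0"] case_prod_unfold)
  have "w i l (xnode g i \<mu>) (ynode g l \<nu>) = 0"
    if "\<mu> \<in> {1..npts g}" "\<nu> \<in> {1..npts g}" for \<mu> \<nu>
    using that quad_points_subset_cell[OF grid, of i l] by (intro assms) (force simp: quad_points_def)
  then have "quad_cell g i l (\<lambda>x y. w i l x y / rho_h e i l x y * h x y) = 0" for h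
    by (subst quad_cell_cong[where h = "\<lambda>_ _. 0"]) auto
  then show "source_X g e i l w v = 0" and "source_Y g e i l w v = 0"
    unfolding source_X_def source_Y_def r by (simp_all add: Let_def)
qed

text \<open>In the second and third components the source cancels the diagonal pressure terms; what
  remains is \<open>C0\<close> times the defect of the discrete divergence theorem, which is zero because
  the Gauss rule integrates the derivative of a test function exactly along grid lines.\<close>

lemma DG_rhs_equilibrium:
  assumes "contact_property_x Fhllc" and "contact_property_y Ghllc" and "poly_deg_le k (v i l)"
  shows "DG_rhs g e Fhllc Ghllc Uh i l v = 0"
proof -
  \<comment> \<open>Equality on the whole cell is used, since the sources contain cell averages
    besides nodal values.\<close>
  have U: "Uh i l x y = equilibrium_state e i l x y" if "(x, y) \<in> cell g i l" for x y
    using Uh_eq neighbours(1) that by auto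
  have sources: "source_X g e i l (\<lambda>i l x y. Uh i l x y $ 2) v = 0"
    "source_X g e i l (\<lambda>i l x y. Uh i l x y $ 3 / 2) v = 0"
    "source_Y g e i l (\<lambda>i l x y. Uh i l x y $ 2 / 2) v = 0"
    "source_Y g e i l (\<lambda>i l x y. Uh i l x y $ 3) v = 0"
    by (rule source_zero; simp add: U equilibrium_state_def)+
  have rho: "Uh i l x y $ 1 = rho_h e i l x y" if "(x, y) \<in> cell g i l" for x y
    by (simp add: U[OF that] equilibrium_state_def)
  show ?thesis
    unfolding DG_rhs_def Let_def volume_F_equilibrium volume_G_equilibrium
      surface_F_equilibrium[OF assms(1)] surface_G_equilibrium[OF assms(2)] sources
      quad_cell_Dx[OF grid assms(3) quadrature_order] quad_cell_Dy[OF grid assms(3) quadrature_order]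
    by (simp add: vec_eq_iff forall_6 source_rho rho)
qed

end

end

section \<open>The time step\<close>

lemma cell_interior_nonempty:
  "valid_grid g \<Longrightarrow> box (xface g (i - 1), yface g (l - 1)) (xface g i, yface g l) \<noteq> {}"
  by (auto simp: valid_grid_def xface_pred[of g i] yface_pred[of g l] box_eq_empty
      Basis_prod_def)

text \<open>A continuous nonnegative function with zero integral over a box with nonempty interior
  vanishes on it; here the function is the square of \<open>f\<close>.\<close>

lemma poly_zero_on_cell:
  assumes "valid_grid g" and "poly_deg_le k f"
    and "integral (cell g i l) (\<lambda>(x, y). f x y * f x y) = 0" and "(x, y) \<in> cell g i l"
  shows "f x y = 0"
proof -
  have "continuous_on (cell g i l) (\<lambda>z. (\<lambda>(x, y). f x y) z * (\<lambda>(x, y). f x y) z)"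
    by (intro continuous_on_mult poly_deg_le_continuous_on[OF assms(2)])
  then have "integral (cell g i l) (\<lambda>(x, y). f x y * f x y) = 0 \<longleftrightarrow>
      (\<forall>z\<in>cell g i l. (\<lambda>(x, y). f x y * f x y) z = 0)"
    using cell_interior_nonempty[OF assms(1)] unfolding cell_def
    by (intro integral_cbox_eq_0_iff) (auto simp: case_prod_unfold)
  then show ?thesis using assms(3,4) by fastforce
qed

theorem theorem4p1:
  fixes g :: grid and k :: nat and e :: equilibrium
    and Fhllc Ghllc :: "state \<Rightarrow> state \<Rightarrow> state"
    and W :: "real \<Rightarrow> real \<Rightarrow> real" and Ue :: "real \<Rightarrow> real \<Rightarrow> state"
    and Uh :: "state piecewise" and dt :: real
  assumes grid: "valid_grid g"
    and quadrature_order: "k \<le> 2 * npts g"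
    and time_step: "0 < dt"
    and hllc_x: "contact_property_x Fhllc"
    and hllc_y: "contact_property_y Ghllc"
    and hydro: "hydrostatic (domain_interior g) W (C0 e) Ue"
    and proj: "projected_equilibrium g k Ue e"
    and adm: "admissible_equilibrium g e"
    and Uh_space: "Uh \<in> DG_space6 (ext_cell_indices g) k"
    and Uh_eq: "\<forall>(i, l)\<in>ext_cell_indices g. \<forall>(x, y)\<in>cell g i l.
                  Uh i l x y = equilibrium_state e i l x y"
  shows "(\<forall>(i, l)\<in>cell_indices g. \<forall>v\<in>DG_space (cell_indices g) k.
            DG_rhs g e Fhllc Ghllc Uh i l v = 0) \<and>
         (\<forall>Unew. euler_step g k e Fhllc Ghllc dt Uh Unew \<longrightarrow>
            (\<forall>(i, l)\<in>cell_indices g. \<forall>(x, y)\<in>cell g i l. Unew i l x y = Uh i l x y))"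
proof -
  interpret discrete_equilibrium g k e Uh
    using grid quadrature_order adm Uh_eq by unfold_locales
  have rhs: "DG_rhs g e Fhllc Ghllc Uh i l v = 0"
    if "(i, l) \<in> cell_indices g" "v \<in> DG_space (cell_indices g) k" for i l v
    using that by (intro DG_rhs_equilibrium hllc_x hllc_y) (auto simp: DG_space_def)
  have "Unew i l x y $ n = Uh i l x y $ n"
    if step: "euler_step g k e Fhllc Ghllc dt Uh Unew"
      and il: "(i, l) \<in> cell_indices g" and xy: "(x, y) \<in> cell g i l" for Unew i l x y n
  proof -
    \<comment> \<open>The bound is stated for every cell, because a test function must be a
      polynomial on all of them.\<close>
    have deg: "poly_deg_le k (\<lambda>x y. Unew i l x y $ m - Uh i l x y $ m)"
      if "(i, l) \<in> cell_indices g" for i l m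
    proof (rule poly_deg_le_diff)
      show "poly_deg_le k (\<lambda>x y. Unew i l x y $ m)"
        using step that by (auto simp: euler_step_def DG_space6_def DG_space_def)
      have "(i, l) \<in> ext_cell_indices g"
        using that by (auto simp: cell_indices_def ext_cell_indices_def)
      then show "poly_deg_le k (\<lambda>x y. Uh i l x y $ m)"
        using Uh_space by (auto simp: DG_space6_def DG_space_def)
    qed
    \<comment> \<open>The scheme is tested with component \<open>n\<close> of its own update, so
      that component \<open>n\<close> of the integrand \<open>D\<close> becomes a square divided by
      \<open>dt\<close>.\<close>
    define v where "v = (\<lambda>i l x y. Unew i l x y $ n - Uh i l x y $ n)"
    have v: "v \<in> DG_space (cell_indices g) k"
      using deg by (auto simp: DG_space_def v_def)
    define D where "D = (\<lambda>(x, y). v i l x y *\<^sub>R ((1 / dt) *\<^sub>R (Unew i l x y - Uh i l x y)))"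
    have "integral (cell g i l) D = 0"
      using step il v rhs[OF il v] unfolding euler_step_def D_def by fastforce
    \<comment> \<open>Continuity of all components gives integrability of \<open>D\<close>, which
      allows a component to be taken under the integral.\<close>
    moreover have "continuous_on (cell g i l) (\<lambda>z. D z $ m)" for m
    proof -
      have "continuous_on (cell g i l) (\<lambda>z. (\<lambda>(x, y). v i l x y) z *
          (1 / dt * (\<lambda>(x, y). Unew i l x y $ m - Uh i l x y $ m) z))"
        unfolding v_def
        by (intro continuous_on_mult continuous_on_const poly_deg_le_continuous_on[OF deg[OF il]])
      then show ?thesis by (simp add: D_def case_prod_unfold)
    qed
    then have "continuous_on (cell g i l) D"
      using continuous_on_vec_lambda[of "cell g i l" "\<lambda>m z. D z $ m"] by (simp add: vec_lambda_eta)
    then have "D integrable_on cell g i l"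
      unfolding cell_def by (rule integrable_continuous)
    ultimately have "integral (cell g i l) (\<lambda>z. D z $ n) = 0"
      by (simp add: integral_component_eq_cart)
    moreover have "(\<lambda>z. D z $ n) = (\<lambda>z. (1 / dt) * (\<lambda>(x, y). v i l x y * v i l x y) z)"
      by (auto simp: D_def v_def)
    ultimately have "integral (cell g i l) (\<lambda>(x, y). v i l x y * v i l x y) = 0"
      using time_step by simp
    moreover have "poly_deg_le k (v i l)"
      using deg[OF il] by (simp add: v_def)
    ultimately have "v i l x y = 0"
      using poly_zero_on_cell[OF grid _ _ xy] by blast
    then show ?thesis by (simp add: v_def)
  qed
  then show ?thesis
    using rhs by (auto simp: vec_eq_iff)
qed

end
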